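(* Let $(W,S)$ be a Coxeter system. If $(W,S)$ is finite and $\Gamma$ is a connected $W$-digraph, then $|\mathscr V(\Gamma)|\le |W|$.
   Context: Coxeter system: $W$ has presentation $\langle s\in S\mid (rs)^{n(r,s)}=e \text{ for } r,s\in S,\ n(r,s)<\infty\rangle$ with $n(s,s)=1$ and $1<n(r,s)=n(s,r)\le\infty$ for $r\ne s$; $\ell$ is the length function. "$(W,S)$ is finite" means $W$ is finite. Hecke algebra: $u$ is an indeterminate and $H$ is the $\mathbb Q(u)$-algebra with basis $\{T_w\mid w\in W\}$ satisfying, for $s\in S$, $T_sT_w=T_{sw}$ if $\ell(sw)>\ell(w)$ and $T_sT_w=u^2T_{sw}+(u^2-1)T_w$ if $\ell(sw)<\ell(w)$. An $S$-labeled digraph is a directed multigraph $\Gamma$ with vertex set $\mathscr V(\Gamma)$ and edge set $\mathscr E(\Gamma)$, in which every edge is either solid or dashed and is labeled by an element of $S$ (written $\alpha\xrightarrow{s}\beta$ if solid, $\alpha\overset{s}{\dashrightarrow}\beta$ if dashed), such that $\Gamma$ has no loops and, for each $s\in S$, every vertex occurs in exactly one edge labeled $s$. It is connected if the underlying undirected multigraph is connected. Let $M(\Gamma)$ be the $\mathbb Q(u)$-vector space with basis $\mathscr V(\Gamma)$. For $s\in S$ let $\tau_s$ be the linear operator on $M(\Gamma)$ with, for each vertex $\alpha$ (where $\beta$ is the other endpoint of the edge labeled $s$ at $\alpha$): $\tau_s(\alpha)=\beta$ if the edge is $\alpha\xrightarrow{s}\beta$; $\tau_s(\alpha)=(u^2-1)\alpha+u^2\beta$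 if it is $\beta\xrightarrow{s}\alpha$; $\tau_s(\alpha)=u\alpha+(u+1)\beta$ if it is $\alpha\overset{s}{\dashrightarrow}\beta$; $\tau_s(\alpha)=(u^2-u-1)\alpha+(u^2-u)\beta$ if it is $\beta\overset{s}{\dashrightarrow}\alpha$. An $S$-labeled digraph $\Gamma$ is a $W$-digraph if $T_s\mapsto\tau_s$ ($s\in S$) extends to a homomorphism of $\mathbb Q(u)$-algebras from $H$ to the algebra of all linear operators on $M(\Gamma)$. *)

theory Defs
  imports
    "HOL-Algebra.Module"
    "HOL-Algebra.Generated_Groups"
    "HOL-Algebra.Algebraic_Closure_Type"
    "HOL-Computational_Algebra.Fraction_Field"
    "HOL-Library.Extended_Nat"
    "Graph_Theory.Digraph_Component"
begin

section \<open>Group presentations and Coxeter systems\<close>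

text \<open>
  A group word is a list of letters; the letter (True, x) stands for x and (False, x) for the
  inverse of x.  Two words over A represent the same element of the group presented by generators A
  and relators R iff they are related by the equivalence closure of deleting a cancelling pair or
  a relator.
\<close>

type_synonym 'a group_word = "(bool \<times> 'a) list"

definition words_over :: "'a set \<Rightarrow> 'a group_word set" where
  "words_over A = lists (UNIV \<times> A)"

inductive word_step :: "'a set \<Rightarrow> 'a group_word set \<Rightarrow> 'a group_word \<Rightarrow> 'a group_word \<Rightarrow> bool"
  for A R where
  cancel: "\<lbrakk>p \<in> words_over A; q \<in> words_over A; x \<in> A\<rbrakk>
    \<Longrightarrow> word_step A R (p @ [(b, x), (\<not> b, x)] @ q) (p @ q)"
| relator: "\<lbrakk>p \<in> words_over A; q \<in> words_over A; r \<in> R\<rbrakk>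
    \<Longrightarrow> word_step A R (p @ r @ q) (p @ q)"

definition word_eval :: "('a, 'b) monoid_scheme \<Rightarrow> 'a group_word \<Rightarrow> 'a" where
  "word_eval G p =
     foldr (\<lambda>(b, x) y. (if b then x else inv\<^bsub>G\<^esub> x) \<otimes>\<^bsub>G\<^esub> y) p \<one>\<^bsub>G\<^esub>"

definition has_presentation ::
  "('a, 'b) monoid_scheme \<Rightarrow> 'a set \<Rightarrow> 'a group_word set \<Rightarrow> bool" where
  "has_presentation G A R \<longleftrightarrow>
     group G \<and> A \<subseteq> carrier G \<and> R \<subseteq> words_over A \<and> generate G A = carrier G \<and>
     (\<forall>p\<in>words_over A. \<forall>q\<in>words_over A.
        word_eval G p = word_eval G q \<longleftrightarrow> equivclp (word_step A R) p q)"

definition coxeter_relators :: "'a set \<Rightarrow> ('a \<Rightarrow> 'a \<Rightarrow> enat) \<Rightarrow> 'a group_word set" where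
  "coxeter_relators S n =
     {concat (replicate k [(True, r), (True, s)]) | k r s. r \<in> S \<and> s \<in> S \<and> n r s = enat k}"

definition coxeter_system ::
  "('w, 'b) monoid_scheme \<Rightarrow> 'w set \<Rightarrow> ('w \<Rightarrow> 'w \<Rightarrow> enat) \<Rightarrow> bool" where
  "coxeter_system W S n \<longleftrightarrow>
     (\<forall>s\<in>S. n s s = 1) \<and>
     (\<forall>r\<in>S. \<forall>s\<in>S. r \<noteq> s \<longrightarrow> 1 < n r s \<and> n r s = n s r) \<and>
     has_presentation W S (coxeter_relators S n)"

definition coxeter_length :: "('w, 'b) monoid_scheme \<Rightarrow> 'w set \<Rightarrow> 'w \<Rightarrow> nat" where
  "coxeter_length W S w =
     (LEAST k. \<exists>xs\<in>lists S. length xs = k \<and> foldr (\<otimes>\<^bsub>W\<^esub>) xs \<one>\<^bsub>W\<^esub> = w)"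


section \<open>Algebras over a commutative ring\<close>

text \<open>The library locale \<^locale>\<open>algebra\<close> requires the algebra to be commutative.\<close>

locale assoc_algebra = module R A + ring A for R and A (structure) +
  assumes smult_mult_left:
      "\<lbrakk>a \<in> carrier R; x \<in> carrier A; y \<in> carrier A\<rbrakk>
        \<Longrightarrow> (a \<odot>\<^bsub>A\<^esub> x) \<otimes>\<^bsub>A\<^esub> y = a \<odot>\<^bsub>A\<^esub> (x \<otimes>\<^bsub>A\<^esub> y)"
    and smult_mult_right:
      "\<lbrakk>a \<in> carrier R; x \<in> carrier A; y \<in> carrier A\<rbrakk>
        \<Longrightarrow> x \<otimes>\<^bsub>A\<^esub> (a \<odot>\<^bsub>A\<^esub> y) = a \<odot>\<^bsub>A\<^esub> (x \<otimes>\<^bsub>A\<^esub> y)"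

definition algebra_hom ::
  "('k, 'r) ring_scheme \<Rightarrow> ('k, 'a, 'c) module_scheme \<Rightarrow> ('k, 'b, 'd) module_scheme \<Rightarrow> ('a \<Rightarrow> 'b) set"
  where
  "algebra_hom R A B =
     {\<phi> \<in> ring_hom A B. \<forall>a\<in>carrier R. \<forall>x\<in>carrier A. \<phi> (a \<odot>\<^bsub>A\<^esub> x) = a \<odot>\<^bsub>B\<^esub> \<phi> x}"

text \<open>
  The family b, indexed by I, is a basis of M: every element is a finite linear combination of the
  family, with unique coefficients (extended by zero outside I).
\<close>

definition is_basis ::
  "('k, 'r) ring_scheme \<Rightarrow> ('k, 'm, 'c) module_scheme \<Rightarrow> 'i set \<Rightarrow> ('i \<Rightarrow> 'm) \<Rightarrow> bool" where
  "is_basis R M I b \<longleftrightarrow>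
     b \<in> I \<rightarrow> carrier M \<and>
     (\<forall>x\<in>carrier M. \<exists>!c.
        (\<forall>i. c i \<in> carrier R) \<and> (\<forall>i. i \<notin> I \<longrightarrow> c i = \<zero>\<^bsub>R\<^esub>) \<and> finite {i. c i \<noteq> \<zero>\<^bsub>R\<^esub>} \<and>
        x = (\<Oplus>\<^bsub>M\<^esub>i\<in>{i. c i \<noteq> \<zero>\<^bsub>R\<^esub>}. c i \<odot>\<^bsub>M\<^esub> b i))"

text \<open>
  The algebra of all linear operators on M; operators are normalised to be undefined outside the
  carrier of M.
\<close>

definition linear_operators ::
  "('k, 'r) ring_scheme \<Rightarrow> ('k, 'm, 'c) module_scheme \<Rightarrow> ('k, 'm \<Rightarrow> 'm) module" where
  "linear_operators R M =
     \<lparr>carrier = {f \<in> carrier M \<rightarrow>\<^sub>E carrier M.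
        (\<forall>x\<in>carrier M. \<forall>y\<in>carrier M. f (x \<oplus>\<^bsub>M\<^esub> y) = f x \<oplus>\<^bsub>M\<^esub> f y) \<and>
        (\<forall>a\<in>carrier R. \<forall>x\<in>carrier M. f (a \<odot>\<^bsub>M\<^esub> x) = a \<odot>\<^bsub>M\<^esub> f x)},
      monoid.mult = (\<lambda>f g. compose (carrier M) f g),
      one = (\<lambda>x\<in>carrier M. x),
      ring.zero = (\<lambda>x\<in>carrier M. \<zero>\<^bsub>M\<^esub>),
      add = (\<lambda>f g. \<lambda>x\<in>carrier M. f x \<oplus>\<^bsub>M\<^esub> g x),
      module.smult = (\<lambda>a f. \<lambda>x\<in>carrier M. a \<odot>\<^bsub>M\<^esub> f x)\<rparr>"


section \<open>The Hecke algebra\<close>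

type_synonym ratfun = "rat poly fract"

abbreviation Qu :: "ratfun ring" where
  "Qu \<equiv> ring_of_type_algebra"

definition u :: ratfun where
  "u = Fract [:0, 1:] 1"

text \<open>
  H is the Hecke algebra of (W, S) with standard basis T.  These conditions determine the pair
  (H, T) up to unique isomorphism.
\<close>

definition hecke_algebra ::
  "('w, 'b) monoid_scheme \<Rightarrow> 'w set \<Rightarrow> (ratfun, 'h) module \<Rightarrow> ('w \<Rightarrow> 'h) \<Rightarrow> bool" where
  "hecke_algebra W S H T \<longleftrightarrow>
     assoc_algebra Qu H \<and> is_basis Qu H (carrier W) T \<and>
     (\<forall>s\<in>S. \<forall>w\<in>carrier W.
        (coxeter_length W S (s \<otimes>\<^bsub>W\<^esub> w) > coxeter_length W S w \<longrightarrow>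
           T s \<otimes>\<^bsub>H\<^esub> T w = T (s \<otimes>\<^bsub>W\<^esub> w)) \<and>
        (coxeter_length W S (s \<otimes>\<^bsub>W\<^esub> w) < coxeter_length W S w \<longrightarrow>
           T s \<otimes>\<^bsub>H\<^esub> T w = u\<^sup>2 \<odot>\<^bsub>H\<^esub> T (s \<otimes>\<^bsub>W\<^esub> w) \<oplus>\<^bsub>H\<^esub> (u\<^sup>2 - 1) \<odot>\<^bsub>H\<^esub> T w))"


section \<open>Labeled digraphs\<close>

record ('v, 'e, 's) labeled_digraph =
  underlying :: "('v, 'e) pre_digraph"
  edge_label :: "'e \<Rightarrow> 's"
  dashed :: "'e \<Rightarrow> bool"

abbreviation vertices :: "('v, 'e, 's) labeled_digraph \<Rightarrow> 'v set" where
  "vertices \<Gamma> \<equiv> verts (underlying \<Gamma>)"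

definition edge_at :: "('v, 'e, 's) labeled_digraph \<Rightarrow> 's \<Rightarrow> 'v \<Rightarrow> 'e \<Rightarrow> bool" where
  "edge_at \<Gamma> s \<alpha> e \<longleftrightarrow>
     e \<in> arcs (underlying \<Gamma>) \<and> edge_label \<Gamma> e = s \<and>
     (tail (underlying \<Gamma>) e = \<alpha> \<or> head (underlying \<Gamma>) e = \<alpha>)"

definition S_labeled_digraph :: "'s set \<Rightarrow> ('v, 'e, 's) labeled_digraph \<Rightarrow> bool" where
  "S_labeled_digraph S \<Gamma> \<longleftrightarrow>
     loopfree_digraph (underlying \<Gamma>) \<and>
     (\<forall>e\<in>arcs (underlying \<Gamma>). edge_label \<Gamma> e \<in> S) \<and>
     (\<forall>s\<in>S. \<forall>\<alpha>\<in>vertices \<Gamma>. \<exists>!e. edge_at \<Gamma> s \<alpha> e)"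

text \<open>
  The Q(u)-vector space with basis V, as finitely supported functions; the multiplicative fields of
  the record play no role.
\<close>

definition vector_space_on :: "'v set \<Rightarrow> (ratfun, 'v \<Rightarrow> ratfun) module" where
  "vector_space_on V =
     \<lparr>carrier = {f. finite {v. f v \<noteq> 0} \<and> (\<forall>v. v \<notin> V \<longrightarrow> f v = 0)},
      monoid.mult = undefined,
      one = undefined,
      ring.zero = (\<lambda>v. 0),
      add = (\<lambda>f g v. f v + g v),
      module.smult = (\<lambda>a f v. a * f v)\<rparr>"

definition basis_vector :: "'v \<Rightarrow> 'v \<Rightarrow> ratfun" where
  "basis_vector \<alpha> = (\<lambda>v. if v = \<alpha> then 1 else 0)"

abbreviation graph_module ::
  "('v, 'e, 's) labeled_digraph \<Rightarrow> (ratfun, 'v \<Rightarrow> ratfun) module" where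
  "graph_module \<Gamma> \<equiv> vector_space_on (vertices \<Gamma>)"

definition tau_vertex :: "('v, 'e, 's) labeled_digraph \<Rightarrow> 's \<Rightarrow> 'v \<Rightarrow> 'v \<Rightarrow> ratfun" where
  "tau_vertex \<Gamma> s \<alpha> =
     (let M = graph_module \<Gamma>;
          e = (THE e. edge_at \<Gamma> s \<alpha> e);
          a = tail (underlying \<Gamma>) e;
          b = head (underlying \<Gamma>) e
      in if \<not> dashed \<Gamma> e then
           if a = \<alpha> then basis_vector b
           else (u\<^sup>2 - 1) \<odot>\<^bsub>M\<^esub> basis_vector \<alpha> \<oplus>\<^bsub>M\<^esub> u\<^sup>2 \<odot>\<^bsub>M\<^esub> basis_vector a
         else
           if a = \<alpha> then u \<odot>\<^bsub>M\<^esub> basis_vector \<alpha> \<oplus>\<^bsub>M\<^esub> (u + 1) \<odot>\<^bsub>M\<^esub> basis_vector b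
           else (u\<^sup>2 - u - 1) \<odot>\<^bsub>M\<^esub> basis_vector \<alpha> \<oplus>\<^bsub>M\<^esub> (u\<^sup>2 - u) \<odot>\<^bsub>M\<^esub> basis_vector a)"

definition tau ::
  "('v, 'e, 's) labeled_digraph \<Rightarrow> 's \<Rightarrow> ('v \<Rightarrow> ratfun) \<Rightarrow> ('v \<Rightarrow> ratfun)" where
  "tau \<Gamma> s =
     (let M = graph_module \<Gamma>
      in (\<lambda>f\<in>carrier M. \<Oplus>\<^bsub>M\<^esub>\<alpha>\<in>{\<alpha>. f \<alpha> \<noteq> 0}. f \<alpha> \<odot>\<^bsub>M\<^esub> tau_vertex \<Gamma> s \<alpha>))"

text \<open>
  The group W enters only through its Hecke algebra H with standard basis T.
\<close>

definition W_digraph ::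
  "'w set \<Rightarrow> (ratfun, 'h) module \<Rightarrow> ('w \<Rightarrow> 'h) \<Rightarrow> ('v, 'e, 'w) labeled_digraph \<Rightarrow> bool" where
  "W_digraph S H T \<Gamma> \<longleftrightarrow>
     S_labeled_digraph S \<Gamma> \<and>
     (\<exists>\<phi>\<in>algebra_hom Qu H (linear_operators Qu (graph_module \<Gamma>)). \<forall>s\<in>S. \<phi> (T s) = tau \<Gamma> s)"

end

theory Submission
  imports Defs "HOL-Library.Function_Algebras"
begin

text \<open>
  The bound holds because the module of a connected W-digraph is cyclic.  Suppose that an edge
  labeled \<open>s\<close> joins the vertices \<open>\<alpha>\<close> and \<open>\<beta>\<close>.  In each of the four cases \<open>\<tau>\<^sub>s(\<alpha>)\<close> is a combination
  of \<open>\<alpha>\<close> and \<open>\<beta>\<close> in which \<open>\<beta>\<close> has one of the nonzero coefficients \<open>1\<close>, \<open>u\<^sup>2\<close>, \<open>u + 1\<close>, \<open>u\<^sup>2 - u\<close>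
  (\<open>tau_edge\<close>).  Hence a subspace that is stable under all \<open>\<tau>\<^sub>s\<close> and contains \<open>\<alpha>\<close> contains \<open>\<beta>\<close>
  as well, and, the digraph being connected, it contains every vertex as soon as it contains one
  (\<open>stable_subspace_contains_vertices\<close>).  The Hecke submodule generated by a vertex is such a
  subspace, so it is everything.

  A module over the Hecke algebra with a single generator is spanned by the images of that generator
  under the |W| basis elements \<open>T\<^sub>w\<close> (\<open>cyclic_submodule_subset_span\<close>).  The vertices are linearly
  independent in this span, so there are at most |W| of them.
\<close>

section \<open>Linear algebra of pointwise operations\<close>

interpretation pointwise: vector_space "\<lambda>(a :: 'k :: field) (f :: 'v \<Rightarrow> 'k) v. a * f v"
  by standard (auto simp: fun_eq_iff algebra_simps)

lemma inj_basis_vector: "inj basis_vector"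
  by (auto simp: inj_def basis_vector_def fun_eq_iff split: if_splits)

text \<open>
  A vertex is outside the span of the others because that span consists of functions vanishing
  at it.
\<close>

lemma independent_basis_vectors: "pointwise.independent (basis_vector ` V)"
proof
  assume "pointwise.dependent (basis_vector ` V)"
  then obtain \<alpha> where
    "basis_vector \<alpha> \<in> pointwise.span (basis_vector ` V - {basis_vector \<alpha>})"
    by (auto simp: pointwise.dependent_def)
  also have "\<dots> \<subseteq> {f. f \<alpha> = 0}"
    by (intro pointwise.span_minimal pointwise.subspaceI) (auto simp: basis_vector_def)
  finally show False
    by (simp add: basis_vector_def)
qed

text \<open>
  With this induction rule a linear statement is checked on basis elements; no map has to be shown
  to commute with finite sums.
\<close>

lemma is_basis_induct [consumes 3, case_names zero add smult]:
  fixes M (structure)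
  assumes "module R M" "is_basis R M I b" "x \<in> carrier M"
    and P_zero: "P \<zero>"
    and P_add: "\<And>x y. x \<in> carrier M \<Longrightarrow> y \<in> carrier M \<Longrightarrow> P x \<Longrightarrow> P y \<Longrightarrow> P (x \<oplus> y)"
    and P_smult: "\<And>a i. a \<in> carrier R \<Longrightarrow> i \<in> I \<Longrightarrow> P (a \<odot>\<^bsub>M\<^esub> b i)"
  shows "P x"
proof -
  interpret module R M by fact
  have b: "b \<in> I \<rightarrow> carrier M"
    using assms(2) by (simp add: is_basis_def)
  obtain c where c: "\<And>i. c i \<in> carrier R" "\<And>i. i \<notin> I \<Longrightarrow> c i = \<zero>\<^bsub>R\<^esub>"
    and fin: "finite {i. c i \<noteq> \<zero>\<^bsub>R\<^esub>}"
    and x: "x = (\<Oplus>i\<in>{i. c i \<noteq> \<zero>\<^bsub>R\<^esub>}. c i \<odot>\<^bsub>M\<^esub> b i)"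
    using assms(2,3) unfolding is_basis_def by blast
  have "P (\<Oplus>i\<in>J. c i \<odot>\<^bsub>M\<^esub> b i)" if "finite J" "J \<subseteq> I" for J
    using that
  proof induction
    case empty
    then show ?case using P_zero by simp
  next
    case (insert i J)
    have "(\<lambda>j. c j \<odot>\<^bsub>M\<^esub> b j) \<in> insert i J \<rightarrow> carrier M"
      using insert.prems b c(1) by auto
    then show ?case
      using insert c(1) by (auto simp: finsum_insert intro!: P_add P_smult)
  qed
  moreover have "{i. c i \<noteq> \<zero>\<^bsub>R\<^esub>} \<subseteq> I"
    using c(2) by auto
  ultimately show ?thesis
    using fin x by simp
qed

section \<open>Operators on the graph module\<close>

lemma abelian_monoid_vector_space_on: "abelian_monoid (vector_space_on V)"
proof (rule abelian_monoidI, goal_cases)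
  case (1 f g)
  then have "{v. f v + g v \<noteq> 0} \<subseteq> {v. f v \<noteq> 0} \<union> {v. g v \<noteq> 0}"
    "finite ({v. f v \<noteq> 0} \<union> {v. g v \<noteq> 0})"
    by (auto simp: vector_space_on_def)
  then have "finite {v. f v + g v \<noteq> 0}"
    by (rule finite_subset)
  with 1 show ?case
    by (simp add: vector_space_on_def)
qed (auto simp: vector_space_on_def algebra_simps)

lemma basis_vector_in_carrier: "\<alpha> \<in> V \<Longrightarrow> basis_vector \<alpha> \<in> carrier (vector_space_on V)"
  by (auto simp: vector_space_on_def basis_vector_def)

lemma tau_basis_vector:
  assumes "\<alpha> \<in> vertices \<Gamma>" and "tau_vertex \<Gamma> s \<alpha> \<in> carrier (graph_module \<Gamma>)"
  shows "tau \<Gamma> s (basis_vector \<alpha>) = tau_vertex \<Gamma> s \<alpha>"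
proof -
  interpret abelian_monoid "graph_module \<Gamma>"
    by (rule abelian_monoid_vector_space_on)
  have supp: "{v. basis_vector \<alpha> v \<noteq> 0} = {\<alpha>}"
    by (auto simp: basis_vector_def)
  have one: "basis_vector \<alpha> \<alpha> \<odot>\<^bsub>graph_module \<Gamma>\<^esub> tau_vertex \<Gamma> s \<alpha> = tau_vertex \<Gamma> s \<alpha>"
    by (simp add: basis_vector_def vector_space_on_def)
  have "tau \<Gamma> s (basis_vector \<alpha>) =
      (\<Oplus>\<^bsub>graph_module \<Gamma>\<^esub>\<beta>\<in>{\<alpha>}. basis_vector \<alpha> \<beta> \<odot>\<^bsub>graph_module \<Gamma>\<^esub> tau_vertex \<Gamma> s \<beta>)"
    using basis_vector_in_carrier[OF assms(1)] by (simp add: tau_def Let_def supp)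
  also have "\<dots> = tau_vertex \<Gamma> s \<alpha>"
    using assms(2) one by (simp add: finsum_insert)
  finally show ?thesis .
qed

lemma u_nonzero_coefficients: "u\<^sup>2 \<noteq> 0" "u + 1 \<noteq> 0" "u\<^sup>2 - u \<noteq> 0"
proof -
  have "u \<noteq> 0" "u + 1 \<noteq> 0" "u - 1 \<noteq> 0"
    by (auto simp: u_def Zero_fract_def One_fract_def eq_fract one_pCons)
  then show "u\<^sup>2 \<noteq> 0" "u + 1 \<noteq> 0" "u\<^sup>2 - u \<noteq> 0"
    by (auto simp: power2_eq_square algebra_simps)
qed

text \<open>
  The two styles of an edge and its two directions differ only in the coefficients.  All that
  matters for reaching \<open>\<beta>\<close> from \<open>\<alpha>\<close> is that the coefficient of \<open>\<beta>\<close> is invertible.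
\<close>

lemma tau_edge:
  assumes \<Gamma>: "S_labeled_digraph S \<Gamma>" and e: "e \<in> arcs (underlying \<Gamma>)"
    and ends: "{\<alpha>, \<beta>} = {tail (underlying \<Gamma>) e, head (underlying \<Gamma>) e}"
  shows "\<exists>a b. b \<noteq> 0 \<and>
    tau \<Gamma> (edge_label \<Gamma> e) (basis_vector \<alpha>) = (\<lambda>v. a * basis_vector \<alpha> v + b * basis_vector \<beta> v)"
proof -
  define s where "s = edge_label \<Gamma> e"
  interpret loopfree_digraph "underlying \<Gamma>"
    using \<Gamma> by (simp add: S_labeled_digraph_def)
  have verts: "\<alpha> \<in> vertices \<Gamma>" "\<beta> \<in> vertices \<Gamma>"
    using ends e tail_in_verts[OF e] head_in_verts[OF e] by (auto simp: doubleton_eq_iff)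
  have at: "edge_at \<Gamma> s \<alpha> e"
    using ends e by (auto simp: edge_at_def s_def doubleton_eq_iff)
  moreover have "\<exists>!e. edge_at \<Gamma> s \<alpha> e"
    using \<Gamma> e verts by (auto simp: S_labeled_digraph_def s_def)
  ultimately have the: "(THE e. edge_at \<Gamma> s \<alpha> e) = e"
    by (rule the1_equality[rotated])
  have "\<exists>a b. b \<noteq> 0 \<and>
      tau_vertex \<Gamma> s \<alpha> = (\<lambda>v. a * basis_vector \<alpha> v + b * basis_vector \<beta> v)" (is "\<exists>a b. ?P a b")
  proof (cases "tail (underlying \<Gamma>) e = \<alpha>")
    case True
    then have "head (underlying \<Gamma>) e = \<beta>"
      using ends by (auto simp: doubleton_eq_iff)
    then have "?P (if dashed \<Gamma> e then u else 0) (if dashed \<Gamma> e then u + 1 else 1)"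
      using True u_nonzero_coefficients
      by (simp add: tau_vertex_def Let_def the vector_space_on_def)
    then show ?thesis by blast
  next
    case False
    then have "tail (underlying \<Gamma>) e = \<beta>"
      using ends by (auto simp: doubleton_eq_iff)
    then have "?P (if dashed \<Gamma> e then u\<^sup>2 - u - 1 else u\<^sup>2 - 1) (if dashed \<Gamma> e then u\<^sup>2 - u else u\<^sup>2)"
      using False u_nonzero_coefficients
      by (simp add: tau_vertex_def Let_def the vector_space_on_def)
    then show ?thesis by blast
  qed
  then obtain a b where ab: "?P a b" by blast
  have "{v. tau_vertex \<Gamma> s \<alpha> v \<noteq> 0} \<subseteq> {\<alpha>, \<beta>}"
    using ab by (auto simp: basis_vector_def split: if_splits)
  then have "tau_vertex \<Gamma> s \<alpha> \<in> carrier (graph_module \<Gamma>)"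
    using verts by (auto simp: vector_space_on_def intro: finite_subset)
  then show ?thesis
    using ab tau_basis_vector verts(1) by (fastforce simp: s_def)
qed

section \<open>Cyclicity\<close>

lemma stable_subspace_contains_vertices:
  assumes \<Gamma>: "S_labeled_digraph S \<Gamma>" and con: "connected (underlying \<Gamma>)"
    and N: "pointwise.subspace N"
    and stable: "\<And>s f. s \<in> S \<Longrightarrow> f \<in> N \<Longrightarrow> tau \<Gamma> s f \<in> N"
    and \<alpha>: "\<alpha> \<in> vertices \<Gamma>" "basis_vector \<alpha> \<in> N"
  shows "basis_vector ` vertices \<Gamma> \<subseteq> N"
proof -
  have neighbor: "basis_vector \<gamma> \<in> N"
    if \<beta>: "basis_vector \<beta> \<in> N" and e: "e \<in> arcs (underlying \<Gamma>)"
      and ends: "{\<beta>, \<gamma>} = {tail (underlying \<Gamma>) e, head (underlying \<Gamma>) e}" for \<beta> \<gamma> e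
  proof -
    define s where "s = edge_label \<Gamma> e"
    have "s \<in> S"
      using \<Gamma> e by (simp add: S_labeled_digraph_def s_def)
    obtain a b where "b \<noteq> 0"
      and ab: "tau \<Gamma> s (basis_vector \<beta>) = (\<lambda>v. a * basis_vector \<beta> v + b * basis_vector \<gamma> v)"
      using tau_edge[OF \<Gamma> e ends] by (auto simp: s_def)
    \<comment> \<open>Solve the equation for the neighbor.\<close>
    have "(\<lambda>v. inverse b * (tau \<Gamma> s (basis_vector \<beta>) - (\<lambda>v. a * basis_vector \<beta> v)) v) \<in> N"
      by (intro pointwise.subspace_scale pointwise.subspace_diff N stable \<open>s \<in> S\<close> \<beta>)
    then show ?thesis
      using \<open>b \<noteq> 0\<close> by (simp add: ab field_simps)
  qed
  have "basis_vector \<beta> \<in> N" if "\<beta> \<in> vertices \<Gamma>" for \<beta>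
  proof -
    have "\<alpha> \<rightarrow>\<^sup>*\<^bsub>with_proj (mk_symmetric (underlying \<Gamma>))\<^esub> \<beta>"
      using con \<alpha>(1) that by (auto simp: connected_def strongly_connected_def)
    then show ?thesis
      unfolding reachable_def
    proof (induction rule: rtrancl_on_induct)
      case (step x y)
      then show ?case
        using neighbor by (auto simp: parcs_mk_symmetric)
    qed (rule \<alpha>(2))
  qed
  then show ?thesis by auto
qed

context
  fixes H :: "(ratfun, 'h) module" and V :: "'v set" and \<phi> m
  assumes H: "assoc_algebra Qu H"
    and \<phi>: "\<phi> \<in> algebra_hom Qu H (linear_operators Qu (vector_space_on V))"
    and m: "m \<in> carrier (vector_space_on V)"
begin

lemma action_add:
  "x \<in> carrier H \<Longrightarrow> y \<in> carrier H \<Longrightarrow> \<phi> (x \<oplus>\<^bsub>H\<^esub> y) m = \<phi> x m + \<phi> y m"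
  using \<phi> m
  by (auto simp: algebra_hom_def ring_hom_def linear_operators_def vector_space_on_def)

lemma action_smult:
  "x \<in> carrier H \<Longrightarrow> \<phi> (a \<odot>\<^bsub>H\<^esub> x) m = (\<lambda>v. a * \<phi> x m v)"
  using \<phi> m
  by (auto simp: algebra_hom_def linear_operators_def vector_space_on_def ring_of_type_algebra_def)

lemma action_mult:
  "x \<in> carrier H \<Longrightarrow> y \<in> carrier H \<Longrightarrow> \<phi> (x \<otimes>\<^bsub>H\<^esub> y) m = \<phi> x (\<phi> y m)"
  using \<phi> m
  by (auto simp: algebra_hom_def ring_hom_def linear_operators_def compose_def)

lemma action_one: "\<phi> \<one>\<^bsub>H\<^esub> m = m"
  using \<phi> m by (auto simp: algebra_hom_def ring_hom_def linear_operators_def)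

lemma action_zero: "\<phi> \<zero>\<^bsub>H\<^esub> m = 0"
proof -
  interpret assoc_algebra Qu H by (rule H)
  show ?thesis
    using action_add[of "\<zero>\<^bsub>H\<^esub>" "\<zero>\<^bsub>H\<^esub>"] by simp
qed

lemma subspace_cyclic_submodule: "pointwise.subspace ((\<lambda>x. \<phi> x m) ` carrier H)"
proof -
  interpret assoc_algebra Qu H by (rule H)
  have "a \<in> carrier Qu" for a :: ratfun
    by (simp add: ring_of_type_algebra_def)
  then show ?thesis
    by (intro pointwise.subspaceI)
      (auto simp flip: action_zero action_add action_smult)
qed

lemma cyclic_submodule_subset_span:
  assumes T: "is_basis Qu H I T"
  shows "(\<lambda>x. \<phi> x m) ` carrier H \<subseteq> pointwise.span ((\<lambda>i. \<phi> (T i) m) ` I)"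
proof (rule image_subsetI)
  fix x assume "x \<in> carrier H"
  with assoc_algebra.axioms(1)[OF H] T
  show "\<phi> x m \<in> pointwise.span ((\<lambda>i. \<phi> (T i) m) ` I)"
  proof (induction rule: is_basis_induct)
    case (smult a i)
    then have "T i \<in> carrier H"
      using T by (auto simp: is_basis_def)
    then show ?case
      using smult pointwise.span_scale[OF pointwise.span_base[of "\<phi> (T i) m"]]
      by (simp add: action_smult)
  next
    case zero
    show ?case
      unfolding action_zero by (rule pointwise.span_zero)
  next
    case (add x y)
    then show ?case
      by (simp only: action_add pointwise.span_add)
  qed
qed

end

theorem corollary1p9:
  fixes W :: "('w, 'b) monoid_scheme"
    and S :: "'w set"
    and n :: "'w \<Rightarrow> 'w \<Rightarrow> enat"
    and H :: "(ratfun, 'h) module"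
    and T :: "'w \<Rightarrow> 'h"
    and \<Gamma> :: "('v, 'e, 'w) labeled_digraph"
  assumes "coxeter_system W S n"
    and "hecke_algebra W S H T"
    and "finite (carrier W)"
    and "W_digraph S H T \<Gamma>"
    and "connected (underlying \<Gamma>)"
  shows "finite (vertices \<Gamma>) \<and> card (vertices \<Gamma>) \<le> card (carrier W)"
proof -
  have H: "assoc_algebra Qu H" and T: "is_basis Qu H (carrier W) T"
    using assms(2) by (auto simp: hecke_algebra_def)
  interpret assoc_algebra Qu H by (rule H)
  have TS: "T s \<in> carrier H" if "s \<in> S" for s
    using assms(1) T that
    by (auto simp: coxeter_system_def has_presentation_def is_basis_def)
  obtain \<phi> where \<Gamma>: "S_labeled_digraph S \<Gamma>"
    and \<phi>: "\<phi> \<in> algebra_hom Qu H (linear_operators Qu (graph_module \<Gamma>))"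
    and tau: "\<And>s. s \<in> S \<Longrightarrow> \<phi> (T s) = tau \<Gamma> s"
    using assms(4) by (auto simp: W_digraph_def)
  obtain \<alpha> where \<alpha>: "\<alpha> \<in> vertices \<Gamma>"
    using assms(5) by (auto simp: connected_def strongly_connected_def)
  define m where "m = basis_vector \<alpha>"
  have m: "m \<in> carrier (graph_module \<Gamma>)"
    unfolding m_def using \<alpha> by (rule basis_vector_in_carrier)
  note action = H \<phi> m
  have "basis_vector ` vertices \<Gamma> \<subseteq> (\<lambda>x. \<phi> x m) ` carrier H"
  proof (rule stable_subspace_contains_vertices[OF \<Gamma> assms(5) _ _ \<alpha>])
    show "pointwise.subspace ((\<lambda>x. \<phi> x m) ` carrier H)"
      by (rule subspace_cyclic_submodule[OF action])
    show "tau \<Gamma> s f \<in> (\<lambda>x. \<phi> x m) ` carrier H"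
      if "s \<in> S" "f \<in> (\<lambda>x. \<phi> x m) ` carrier H" for s f
      using that TS by (auto simp flip: tau action_mult[OF action])
    show "basis_vector \<alpha> \<in> (\<lambda>x. \<phi> x m) ` carrier H"
      using action_one[OF action] by (force simp: m_def)
  qed
  also have "\<dots> \<subseteq> pointwise.span ((\<lambda>w. \<phi> (T w) m) ` carrier W)"
    by (rule cyclic_submodule_subset_span[OF action T])
  finally have "finite (basis_vector ` vertices \<Gamma>) \<and>
      card (basis_vector ` vertices \<Gamma>) \<le> card ((\<lambda>w. \<phi> (T w) m) ` carrier W)"
    using assms(3) by (intro pointwise.independent_span_bound independent_basis_vectors) auto
  then have "finite (vertices \<Gamma>)" "card (vertices \<Gamma>) \<le> card ((\<lambda>w. \<phi> (T w) m) ` carrier W)"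
    using inj_on_subset[OF inj_basis_vector, of "vertices \<Gamma>"]
    by (simp_all add: finite_image_iff card_image)
  with card_image_le[OF assms(3)] show ?thesis
    by (blast intro: order_trans)
qed

end
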